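(* Let $k$ be a field of characteristic zero. For every integer $r\ge 3$, there exist non-unimodal monomial artinian level algebras of codimension $r$; that is, there exists a monomial ideal $I\subset k[x_1,\dots,x_r]$, containing no nonzero forms of degree one, such that $k[x_1,\dots,x_r]/I$ is an artinian level algebra whose $h$-vector is not unimodal.
   Context: All algebras are standard graded quotients $A=R/I$ with $R=k[x_1,\dots,x_r]$ and $I$ homogeneous. If $A$ is artinian, its $h$-vector is $(h_0,\dots,h_e)$ with $h_i=\dim_k A_i$, where $e$ (the socle degree) is the last index with $A_e\neq0$; the codimension of $A$ is $h_1$. The socle of $A$ is the annihilator in $A$ of the maximal homogeneous ideal; $A$ is level if its socle is concentrated in degree $e$. The algebra is monomial if $I$ is generated by monomials. An $h$-vector is unimodal if $h_0\le h_1\le\dots\le h_j\ge h_{j+1}\ge\dots\ge h_e$ for some $j$; an algebra is called non-unimodal if its $h$-vector is not unimodal. *)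

theory Defs
  imports "HOL-Algebra.QuotRing" "HOL-Algebra.Embedded_Algebras" "HOL-Library.Poly_Mapping"
begin

section \<open>Polynomial rings\<close>

text \<open>
  A monomial is an exponent vector, and a polynomial is a finitely supported map from monomials
  to coefficients. The variables are indexed by all natural numbers; the polynomial ring
  \<open>k[x\<^sub>1, \<dots>, x\<^sub>r]\<close> is the subring of those polynomials in which only the variables
  with index in \<open>{..<r}\<close> occur, and it is packaged as a ring of the algebra library so that
  ideals, quotient rings and dimensions can be taken from there.
\<close>

type_synonym 'k mpoly = "(nat \<Rightarrow>\<^sub>0 nat) \<Rightarrow>\<^sub>0 'k"

definition exponents :: "nat \<Rightarrow> (nat \<Rightarrow>\<^sub>0 nat) set" where
  "exponents r = {m. Poly_Mapping.keys m \<subseteq> {..<r}}"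

definition mon_degree :: "(nat \<Rightarrow>\<^sub>0 nat) \<Rightarrow> nat" where
  "mon_degree m = (\<Sum>i\<in>Poly_Mapping.keys m. Poly_Mapping.lookup m i)"

definition poly_ring :: "nat \<Rightarrow> 'k::field mpoly ring" where
  "poly_ring r = \<lparr>carrier = {p. Poly_Mapping.keys p \<subseteq> exponents r},
     monoid.mult = (*), monoid.one = 1, ring.zero = 0, ring.add = (+)\<rparr>"

lemma exponents_add: "m \<in> exponents r \<Longrightarrow> n \<in> exponents r \<Longrightarrow> m + n \<in> exponents r"
  using Poly_Mapping.keys_add[of m n] by (auto simp: exponents_def)

lemma cring_poly_ring: "cring (poly_ring r :: 'k::field mpoly ring)"
proof (rule cringI)
  show "abelian_group (poly_ring r :: 'k mpoly ring)"
  proof (rule abelian_groupI)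
    fix p q :: "'k mpoly"
    assume "p \<in> carrier (poly_ring r)" "q \<in> carrier (poly_ring r)"
    then show "p \<oplus>\<^bsub>poly_ring r\<^esub> q \<in> carrier (poly_ring r)"
      using Poly_Mapping.keys_add[of p q] by (auto simp: poly_ring_def)
  next
    fix p :: "'k mpoly"
    assume "p \<in> carrier (poly_ring r)"
    then show "\<exists>q\<in>carrier (poly_ring r). q \<oplus>\<^bsub>poly_ring r\<^esub> p = \<zero>\<^bsub>poly_ring r\<^esub>"
      by (intro bexI[of _ "- p"]) (auto simp: poly_ring_def)
  qed (auto simp: poly_ring_def add_ac)
  show "Group.comm_monoid (poly_ring r :: 'k mpoly ring)"
  proof (rule comm_monoidI)
    fix p q :: "'k mpoly"
    assume "p \<in> carrier (poly_ring r)" "q \<in> carrier (poly_ring r)"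
    then show "p \<otimes>\<^bsub>poly_ring r\<^esub> q \<in> carrier (poly_ring r)"
      using Poly_Mapping.keys_mult[of p q] exponents_add
      by (fastforce simp: poly_ring_def)
  qed (auto simp: poly_ring_def mult_ac exponents_def)
qed (auto simp: poly_ring_def distrib_right)

definition forms :: "nat \<Rightarrow> nat \<Rightarrow> 'k::field mpoly set" where
  "forms r i = {p \<in> carrier (poly_ring r). \<forall>m\<in>Poly_Mapping.keys p. mon_degree m = i}"

definition monomial_ideal :: "nat \<Rightarrow> 'k::field mpoly set \<Rightarrow> bool" where
  "monomial_ideal r I \<longleftrightarrow>
     (\<exists>M\<subseteq>exponents r. I = Idl\<^bsub>poly_ring r\<^esub> ((\<lambda>m. Poly_Mapping.single m 1) ` M))"


section \<open>Graded quotients\<close>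

definition quot_alg :: "nat \<Rightarrow> 'k::field mpoly set \<Rightarrow> 'k mpoly set ring" where
  "quot_alg r I = poly_ring r Quot I"

definition quot_map :: "nat \<Rightarrow> 'k::field mpoly set \<Rightarrow> 'k mpoly \<Rightarrow> 'k mpoly set" where
  "quot_map r I p = I +>\<^bsub>poly_ring r\<^esub> p"

text \<open>The copy of the ground field \<open>k\<close> inside \<open>A = R/I\<close>.\<close>

definition scalars :: "nat \<Rightarrow> 'k::field mpoly set \<Rightarrow> 'k mpoly set set" where
  "scalars r I = quot_map r I ` (\<lambda>c. Poly_Mapping.single 0 c) ` UNIV"

text \<open>The graded piece \<open>A\<^sub>i\<close> of \<open>A = R/I\<close>, i.e. the image of \<open>R\<^sub>i\<close>, for homogeneous \<open>I\<close>.\<close>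

definition graded_piece :: "nat \<Rightarrow> 'k::field mpoly set \<Rightarrow> nat \<Rightarrow> 'k mpoly set set" where
  "graded_piece r I i = quot_map r I ` forms r i"

definition hilb :: "nat \<Rightarrow> 'k::field mpoly set \<Rightarrow> nat \<Rightarrow> nat" where
  "hilb r I i = ring.dim (quot_alg r I) (scalars r I) (graded_piece r I i)"

definition codimension :: "nat \<Rightarrow> 'k::field mpoly set \<Rightarrow> nat" where
  "codimension r I = hilb r I 1"

definition artinian_ring :: "('a, 'b) ring_scheme \<Rightarrow> bool" where
  "artinian_ring A \<longleftrightarrow> ring A \<and>
     (\<forall>J :: nat \<Rightarrow> 'a set. (\<forall>n. ideal (J n) A \<and> J (Suc n) \<subseteq> J n) \<longrightarrow> (\<exists>N. \<forall>n\<ge>N. J n = J N))"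

text \<open>Meaningful for artinian \<open>A \<noteq> 0\<close>; otherwise the greatest index need not exist.\<close>

definition socle_degree :: "nat \<Rightarrow> 'k::field mpoly set \<Rightarrow> nat" where
  "socle_degree r I = (GREATEST i. graded_piece r I i \<noteq> {\<zero>\<^bsub>quot_alg r I\<^esub>})"

text \<open>
  The maximal homogeneous ideal of \<open>A\<close> is the image of the polynomials all of whose
  monomials have positive degree.
\<close>

definition max_hom_ideal :: "nat \<Rightarrow> 'k::field mpoly set \<Rightarrow> 'k mpoly set set" where
  "max_hom_ideal r I =
     quot_map r I ` {p \<in> carrier (poly_ring r). \<forall>m\<in>Poly_Mapping.keys p. 0 < mon_degree m}"

definition socle :: "nat \<Rightarrow> 'k::field mpoly set \<Rightarrow> 'k mpoly set set" where
  "socle r I = {a \<in> carrier (quot_alg r I).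
     \<forall>b\<in>max_hom_ideal r I. a \<otimes>\<^bsub>quot_alg r I\<^esub> b = \<zero>\<^bsub>quot_alg r I\<^esub>}"

definition level :: "nat \<Rightarrow> 'k::field mpoly set \<Rightarrow> bool" where
  "level r I \<longleftrightarrow> socle r I \<subseteq> graded_piece r I (socle_degree r I)"

definition h_vector :: "nat \<Rightarrow> 'k::field mpoly set \<Rightarrow> nat list" where
  "h_vector r I = map (hilb r I) [0..<Suc (socle_degree r I)]"

definition unimodal :: "nat list \<Rightarrow> bool" where
  "unimodal h \<longleftrightarrow> (\<exists>j<length h.
     (\<forall>i<j. h ! i \<le> h ! Suc i) \<and>
     (\<forall>i. j \<le> i \<and> Suc i < length h \<longrightarrow> h ! Suc i \<le> h ! i))"

end

theory Submission
  imports Defs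
begin

text \<open>
  A pure finite order ideal \<open>N\<close> of monomials, all of whose maximal elements have degree \<open>e\<close>, is
  a basis of the quotient by the monomials outside \<open>N\<close>. That quotient is artinian and level with
  socle degree \<open>e\<close>, and its \<open>h\<close>-vector counts the elements of \<open>N\<close> by degree.

  Take \<open>e = 12\<close>, and let \<open>N\<close> consist of the divisors of \<open>(x\<^sub>1x\<^sub>2x\<^sub>3)\<^sup>4\<close>, the monomials of degree
  at most 12 in at most two of \<open>x\<^sub>1, x\<^sub>2, x\<^sub>3\<close>, and the powers \<open>x\<^sub>j\<^sup>d\<close> with \<open>j > 3\<close> and \<open>d \<le> 12\<close>.
  There are \<open>3d\<close> monomials of degree \<open>d \<ge> 1\<close> in at most two of the three variables, while the
  multiples of \<open>x\<^sub>1x\<^sub>2x\<^sub>3\<close> dividing \<open>(x\<^sub>1x\<^sub>2x\<^sub>3)\<^sup>4\<close> number 10, 6, 3, 1 in degrees 9, 10, 11, 12. Up to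
  the summand \<open>r - 3\<close> from the other variables, the \<open>h\<close>-vector therefore ends in 37, 36, 36, 37.
\<close>

section \<open>Polynomials and monomials\<close>

lemma lookup_scale [simp]:
  fixes p :: "'k::field mpoly"
  shows "Poly_Mapping.lookup (Poly_Mapping.single 0 c * p) m = c * Poly_Mapping.lookup p m"
  by (simp add: mult_map_scale_conv_mult[symmetric] Poly_Mapping.map.rep_eq when_def)

text \<open>Adding \<open>n\<close> is injective on exponent vectors, so after the
  \<open>m\<close>-term of \<open>p\<close> is split off, no term of the remainder can land on
  \<open>m + n\<close>. Multiplying by a monomial therefore shifts coefficients without
  cancellation.\<close>

lemma lookup_times_monom:
  fixes p :: "'k::field mpoly"
  shows "Poly_Mapping.lookup (p * Poly_Mapping.single n 1) (m + n) = Poly_Mapping.lookup p m"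
proof -
  define c where "c = Poly_Mapping.lookup p m"
  define q where "q = p - Poly_Mapping.single m c"
  have "m \<notin> Poly_Mapping.keys q"
    by (simp add: q_def c_def in_keys_iff lookup_minus)
  then have "m + n \<notin> Poly_Mapping.keys (q * Poly_Mapping.single n 1)"
    using Poly_Mapping.keys_mult[of q "Poly_Mapping.single n 1"] by auto
  moreover have "p * Poly_Mapping.single n 1 = Poly_Mapping.single (m + n) c + q * Poly_Mapping.single n 1"
    by (simp add: q_def left_diff_distrib mult_single)
  ultimately show ?thesis
    by (simp add: lookup_add c_def in_keys_iff)
qed

lemma sum_monomials:
  fixes p :: "'k::field mpoly"
  shows "p = (\<Sum>m\<in>Poly_Mapping.keys p. Poly_Mapping.single m (Poly_Mapping.lookup p m))"
  by (rule poly_mapping_eqI) (auto simp: lookup_sum lookup_single when_def in_keys_iff)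

lemma mon_degree_superset:
  assumes "finite A" "Poly_Mapping.keys m \<subseteq> A"
  shows "mon_degree m = (\<Sum>i\<in>A. Poly_Mapping.lookup m i)"
  unfolding mon_degree_def
  by (rule sum.mono_neutral_left) (use assms in \<open>auto simp: in_keys_iff\<close>)

lemma mon_degree_add [simp]: "mon_degree (m + n) = mon_degree m + mon_degree n"
proof -
  let ?A = "Poly_Mapping.keys m \<union> Poly_Mapping.keys n"
  have "mon_degree (m + n) = (\<Sum>i\<in>?A. Poly_Mapping.lookup (m + n) i)"
    using Poly_Mapping.keys_add[of m n] by (intro mon_degree_superset) auto
  also have "\<dots> = mon_degree m + mon_degree n"
    using mon_degree_superset[of ?A m] mon_degree_superset[of ?A n]
    by (simp add: lookup_add sum.distrib)
  finally show ?thesis .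
qed

lemma mon_degree_single [simp]: "mon_degree (Poly_Mapping.single i a) = a"
  by (simp add: mon_degree_def)

lemma mon_degree_eq_0_iff: "mon_degree m = 0 \<longleftrightarrow> m = 0"
  by (auto simp: mon_degree_def in_keys_iff)  (metis in_keys_iff keys_eq_empty ex_in_conv)

lemma poly_ring_simps [simp]:
  "monoid.mult (poly_ring r) = (*)" "monoid.one (poly_ring r) = 1"
  "ring.zero (poly_ring r) = 0" "ring.add (poly_ring r) = (+)"
  by (simp_all add: poly_ring_def)

lemma in_carrier_poly_ring: "p \<in> carrier (poly_ring r) \<longleftrightarrow> Poly_Mapping.keys p \<subseteq> exponents r"
  by (simp add: poly_ring_def)

lemma single_in_exponents: "i < r \<Longrightarrow> Poly_Mapping.single i a \<in> exponents r"
  by (simp add: exponents_def)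

lemma a_inv_poly_ring:
  fixes p :: "'k::field mpoly"
  assumes "p \<in> carrier (poly_ring r)"
  shows "\<ominus>\<^bsub>poly_ring r\<^esub> p = - p"
proof -
  interpret P: cring "poly_ring r :: 'k mpoly ring" by (rule cring_poly_ring)
  show ?thesis
    by (rule P.minus_equality) (use assms in \<open>auto simp: in_carrier_poly_ring\<close>)
qed

text \<open>The descending chain condition for subspaces of a finite-dimensional space. The
  induction removes one coordinate at a time, which avoids any appeal to dimension. Closure under
  \<open>p - c q\<close>, together with \<open>0\<close>, encodes being a subspace.\<close>

lemma decreasing_subspaces_stabilise:
  fixes V :: "nat \<Rightarrow> 'k::field mpoly set"
  assumes "finite T"
    and "\<And>n. 0 \<in> V n"
    and "\<And>n p. p \<in> V n \<Longrightarrow> Poly_Mapping.keys p \<subseteq> T"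
    and "\<And>n p q c. p \<in> V n \<Longrightarrow> q \<in> V n \<Longrightarrow> p - Poly_Mapping.single 0 c * q \<in> V n"
    and "\<And>n. V (Suc n) \<subseteq> V n"
  shows "\<exists>N. \<forall>n\<ge>N. V n = V N"
  using assms
proof (induction T arbitrary: V rule: finite_induct)
  case empty
  have "V n = {0}" for n
    using empty(1)[of n] empty(2)[where n = n] by auto
  then show ?case by auto
next
  case (insert m T)
  have mono: "V n \<subseteq> V N" if "N \<le> n" for n N
    by (rule lift_Suc_antimono_le) (use insert.prems(4) that in auto)
  \<comment> \<open>The kernel of the coefficient functional at \<open>m\<close>, a chain supported
    on the smaller set \<open>T\<close>.\<close>
  define W where "W n = {p \<in> V n. Poly_Mapping.lookup p m = 0}" for n
  have "\<exists>N. \<forall>n\<ge>N. W n = W N"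
  proof (rule insert.IH)
    fix n p assume "p \<in> W n"
    then show "Poly_Mapping.keys p \<subseteq> T"
      using insert.prems(2)[where n = n and p = p] by (auto simp: W_def in_keys_iff)
  next
    fix n show "W (Suc n) \<subseteq> W n"
      using insert.prems(4)[of n] by (auto simp: W_def)
  qed (use insert.prems in \<open>auto simp: W_def lookup_minus\<close>)
  then obtain N1 where N1: "\<And>n. n \<ge> N1 \<Longrightarrow> W n = W N1" by blast
  define lead where "lead n \<longleftrightarrow> (\<exists>q\<in>V n. Poly_Mapping.lookup q m \<noteq> 0)" for n
  \<comment> \<open>As \<open>V\<close> decreases, \<open>lead\<close> can only switch from true to
    false, so it is eventually constant. If it never switches, \<open>N2\<close> is
    arbitrary.\<close>
  obtain N2 where N2: "(\<forall>n. lead n) \<or> (\<forall>n\<ge>N2. \<not> lead n)"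
    using mono unfolding lead_def by blast
  define N where "N = max N1 N2"
  have "V N \<subseteq> V n" if "n \<ge> N" for n
  proof
    fix p assume p: "p \<in> V N"
    have W: "W N = W n"
      using N1[of n] N1[of N] that by (simp add: N_def)
    show "p \<in> V n"
    proof (cases "Poly_Mapping.lookup p m = 0")
      case True
      then show ?thesis using p W by (auto simp: W_def)
    next
      case False
      then have "lead N" using p by (auto simp: lead_def)
      then have "lead n" using N2 by (auto simp: N_def)
      then obtain q where q: "q \<in> V n" "Poly_Mapping.lookup q m \<noteq> 0"
        by (auto simp: lead_def)
      \<comment> \<open>This multiple of \<open>q\<close> cancels the coefficient of
        \<open>p\<close> at \<open>m\<close>, which moves the difference into
        \<open>W\<close>.\<close>
      define c where "c = Poly_Mapping.lookup p m / Poly_Mapping.lookup q m"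
      have "p - Poly_Mapping.single 0 c * q \<in> W N"
        using p q mono[OF that] insert.prems(3)[where n = N and p = p and q = q and c = c]
        by (auto simp: W_def lookup_minus c_def)
      then have "p - Poly_Mapping.single 0 c * q \<in> V n"
        using W by (auto simp: W_def)
      \<comment> \<open>Adding \<open>c q\<close> back is written as subtracting \<open>-c\<close>
        times \<open>q\<close>, the form in which closure is assumed.\<close>
      then have "(p - Poly_Mapping.single 0 c * q) - Poly_Mapping.single 0 (-c) * q \<in> V n"
        using q(1) by (rule insert.prems(3))
      moreover have "(p - Poly_Mapping.single 0 c * q) - Poly_Mapping.single 0 (-c) * q = p"
        by (rule poly_mapping_eqI) (simp add: lookup_minus)
      ultimately show ?thesis by simp
    qed
  qed
  then show ?case using mono by blast
qed

section \<open>Quotients defined by pure order ideals of monomials\<close>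

text \<open>Purity is stated as a one-step extension: below degree \<open>e\<close>, multiplication
  by some variable stays inside \<open>N\<close>. This says that maximal elements have degree
  \<open>e\<close>, in the form that the socle computation needs.\<close>

locale pure_order_ideal =
  fixes r e :: nat and N :: "(nat \<Rightarrow>\<^sub>0 nat) set"
  assumes N_exponents: "N \<subseteq> exponents r"
    and finite_N: "finite N"
    and zero_in_N: "0 \<in> N"
    and divisor_closed: "m + n \<in> N \<Longrightarrow> m \<in> N"
    and degree_le: "m \<in> N \<Longrightarrow> mon_degree m \<le> e"
    and pure: "m \<in> N \<Longrightarrow> mon_degree m < e \<Longrightarrow> \<exists>i<r. m + Poly_Mapping.single i 1 \<in> N"
begin

section \<open>The ideal spanned by the monomials outside the order ideal\<close>

text \<open>Describing the ideal by supports instead of generators makes membership a condition on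
  coefficients.\<close>

definition complement_ideal :: "'k::field mpoly set" where
  "complement_ideal = {p \<in> carrier (poly_ring r). Poly_Mapping.keys p \<inter> N = {}}"

text \<open>Closure under multiplication is the contrapositive of \<open>divisor_closed\<close>: a
  multiple of a monomial outside \<open>N\<close> is again outside \<open>N\<close>.\<close>

lemma ideal_complement_ideal: "ideal complement_ideal (poly_ring r :: 'k::field mpoly ring)"
proof -
  interpret P: cring "poly_ring r :: 'k mpoly ring" by (rule cring_poly_ring)
  have closed: "x * p \<in> complement_ideal" if "p \<in> complement_ideal" "x \<in> carrier (poly_ring r)"
    for p x :: "'k mpoly"
  proof -
    have "m \<notin> N" if m: "m \<in> Poly_Mapping.keys (x * p)" for m
    proof -
      obtain a b where "m = b + a" "b \<in> Poly_Mapping.keys p"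
        using m Poly_Mapping.keys_mult[of x p] by (auto simp: add.commute)
      then show ?thesis
        using divisor_closed[of b a] \<open>p \<in> complement_ideal\<close> by (auto simp: complement_ideal_def)
    qed
    moreover have "x * p \<in> carrier (poly_ring r)"
      using P.m_closed[of x p] that by (simp add: complement_ideal_def)
    ultimately show ?thesis by (auto simp: complement_ideal_def)
  qed
  show ?thesis
  proof (rule idealI[OF P.ring_axioms])
    show "subgroup complement_ideal (add_monoid (poly_ring r :: 'k mpoly ring))"
    proof (rule P.add.subgroupI)
      fix p q :: "'k mpoly" assume pq: "p \<in> complement_ideal" "q \<in> complement_ideal"
      then show "p \<oplus>\<^bsub>poly_ring r\<^esub> q \<in> complement_ideal"
        using Poly_Mapping.keys_add[of p q] by (auto simp: complement_ideal_def in_carrier_poly_ring)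
      show "\<ominus>\<^bsub>poly_ring r\<^esub> p \<in> complement_ideal"
        using pq(1) by (simp add: complement_ideal_def a_inv_poly_ring in_carrier_poly_ring)
    next
      show "complement_ideal \<noteq> ({} :: 'k mpoly set)"
        by (auto simp: complement_ideal_def in_carrier_poly_ring intro!: exI[of _ 0])
    qed (auto simp: complement_ideal_def)
  qed (use closed in \<open>auto simp: mult.commute\<close>)
qed

text \<open>All monomials outside \<open>N\<close> serve as generators, since each element of the
  ideal is the sum of its own terms.\<close>

lemma monomial_ideal_complement_ideal: "monomial_ideal r (complement_ideal :: 'k::field mpoly set)"
proof -
  interpret P: cring "poly_ring r :: 'k mpoly ring" by (rule cring_poly_ring)
  let ?G = "(\<lambda>m. Poly_Mapping.single m 1) ` (exponents r - N) :: 'k mpoly set"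
  have G: "?G \<subseteq> carrier (poly_ring r)"
    by (auto simp: in_carrier_poly_ring)
  interpret J: ideal "Idl\<^bsub>poly_ring r\<^esub> ?G" "poly_ring r :: 'k mpoly ring"
    by (rule P.genideal_ideal[OF G])
  have "p \<in> Idl\<^bsub>poly_ring r\<^esub> ?G" if "p \<in> complement_ideal" for p :: "'k mpoly"
  proof -
    have "(\<Sum>m\<in>A. Poly_Mapping.single m (Poly_Mapping.lookup p m)) \<in> Idl\<^bsub>poly_ring r\<^esub> ?G"
      if "finite A" "A \<subseteq> Poly_Mapping.keys p" for A
      using that
    proof (induction A rule: finite_induct)
      case empty
      then show ?case using J.zero_closed by simp
    next
      case (insert m A)
      have "Poly_Mapping.single m 1 \<in> ?G"
        using insert.prems \<open>p \<in> complement_ideal\<close>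
        by (auto simp: complement_ideal_def in_carrier_poly_ring)
      then have "Poly_Mapping.single m 1 \<in> Idl\<^bsub>poly_ring r\<^esub> ?G"
        using P.genideal_self[OF G] by blast
      moreover have "Poly_Mapping.single 0 (Poly_Mapping.lookup p m) \<in> carrier (poly_ring r)"
        by (simp add: in_carrier_poly_ring exponents_def)
      ultimately have "Poly_Mapping.single 0 (Poly_Mapping.lookup p m) * Poly_Mapping.single m 1
          \<in> Idl\<^bsub>poly_ring r\<^esub> ?G"
        using J.I_l_closed by simp
      then have "Poly_Mapping.single m (Poly_Mapping.lookup p m) \<in> Idl\<^bsub>poly_ring r\<^esub> ?G"
        by (simp add: mult_single)
      then show ?case
        using insert J.a_closed by simp
    qed
    from this[of "Poly_Mapping.keys p"] show ?thesis
      by (simp flip: sum_monomials)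
  qed
  moreover have "Idl\<^bsub>poly_ring r\<^esub> ?G \<subseteq> complement_ideal"
    by (rule P.genideal_minimal[OF ideal_complement_ideal])
      (auto simp: complement_ideal_def in_carrier_poly_ring)
  ultimately show ?thesis
    unfolding monomial_ideal_def by (intro exI[of _ "exponents r - N"]) blast
qed

section \<open>The quotient map and normal forms\<close>

abbreviation coset :: "'k::field mpoly \<Rightarrow> 'k mpoly set" where
  "coset \<equiv> quot_map r complement_ideal"

lemma ring_hom_coset:
  "ring_hom_ring (poly_ring r :: 'k::field mpoly ring) (quot_alg r complement_ideal) coset"
  using ideal.rcos_ring_hom_ring[OF ideal_complement_ideal]
  by (simp add: quot_alg_def quot_map_def[abs_def])

lemma carrier_quot_alg:
  "carrier (quot_alg r complement_ideal) = coset ` carrier (poly_ring r :: 'k::field mpoly ring)"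
  by (auto simp: quot_alg_def quot_map_def FactRing_def A_RCOSETS_def')

lemma coset_add:
  fixes p q :: "'k::field mpoly"
  assumes "p \<in> carrier (poly_ring r)" "q \<in> carrier (poly_ring r)"
  shows "coset (p + q) = coset p \<oplus>\<^bsub>quot_alg r complement_ideal\<^esub> coset q"
proof -
  interpret h: ring_hom_ring "poly_ring r :: 'k mpoly ring" "quot_alg r complement_ideal" coset
    by (rule ring_hom_coset)
  show ?thesis using h.hom_add[OF assms] by simp
qed

lemma coset_mult:
  fixes p q :: "'k::field mpoly"
  assumes "p \<in> carrier (poly_ring r)" "q \<in> carrier (poly_ring r)"
  shows "coset (p * q) = coset p \<otimes>\<^bsub>quot_alg r complement_ideal\<^esub> coset q"
proof -
  interpret h: ring_hom_ring "poly_ring r :: 'k mpoly ring" "quot_alg r complement_ideal" coset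
    by (rule ring_hom_coset)
  show ?thesis using h.hom_mult[OF assms] by simp
qed

text \<open>Two cosets agree when the difference of the representatives is supported off
  \<open>N\<close>. The coefficients on \<open>N\<close> are thus coordinates on the
  quotient.\<close>

lemma coset_eq_iff:
  fixes p q :: "'k::field mpoly"
  assumes "p \<in> carrier (poly_ring r)" "q \<in> carrier (poly_ring r)"
  shows "coset p = coset q \<longleftrightarrow> (\<forall>m\<in>N. Poly_Mapping.lookup p m = Poly_Mapping.lookup q m)"
proof -
  interpret P: cring "poly_ring r :: 'k mpoly ring" by (rule cring_poly_ring)
  have diff: "p \<ominus>\<^bsub>poly_ring r\<^esub> q = p - q"
    using assms by (simp add: a_minus_def a_inv_poly_ring)
  have "coset p = coset q \<longleftrightarrow> p - q \<in> complement_ideal"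
    unfolding quot_map_def diff[symmetric]
    using P.quotient_eq_iff_same_a_r_cos[OF ideal_complement_ideal assms] by (rule sym)
  also have "\<dots> \<longleftrightarrow> (\<forall>m\<in>N. Poly_Mapping.lookup p m = Poly_Mapping.lookup q m)"
    using P.minus_closed[OF assms] unfolding diff complement_ideal_def
    by (auto simp: in_keys_iff lookup_minus)
  finally show ?thesis .
qed

lemma coset_eq_zero_iff:
  fixes p :: "'k::field mpoly"
  assumes "p \<in> carrier (poly_ring r)"
  shows "coset p = \<zero>\<^bsub>quot_alg r complement_ideal\<^esub> \<longleftrightarrow> Poly_Mapping.keys p \<inter> N = {}"
proof -
  interpret h: ring_hom_ring "poly_ring r :: 'k mpoly ring" "quot_alg r complement_ideal" coset
    by (rule ring_hom_coset)
  have "\<zero>\<^bsub>quot_alg r complement_ideal\<^esub> = coset (0 :: 'k mpoly)"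
    using h.hom_zero by (simp only: poly_ring_simps)
  then show ?thesis
    using coset_eq_iff[OF assms, of 0] by (auto simp: in_carrier_poly_ring in_keys_iff)
qed

text \<open>Deleting the terms outside \<open>N\<close> does not change the coset; the rest is the
  canonical representative.\<close>

lemma normal_form:
  fixes p :: "'k::field mpoly"
  assumes "p \<in> carrier (poly_ring r)"
  obtains q where "coset q = coset p" "Poly_Mapping.keys q = Poly_Mapping.keys p \<inter> N"
proof
  define q where
    "q = (\<Sum>m\<in>Poly_Mapping.keys p \<inter> N. Poly_Mapping.single m (Poly_Mapping.lookup p m))"
  have lookup_q: "Poly_Mapping.lookup q m = (if m \<in> N then Poly_Mapping.lookup p m else 0)" for m
    by (auto simp: q_def lookup_sum lookup_single when_def in_keys_iff)
  show keys_q: "Poly_Mapping.keys q = Poly_Mapping.keys p \<inter> N"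
    by (auto simp: in_keys_iff lookup_q split: if_splits)
  show "coset q = coset p"
    using assms keys_q by (subst coset_eq_iff) (auto simp: in_carrier_poly_ring lookup_q)
qed

section \<open>The Hilbert function of the quotient\<close>

text \<open>The constants form a field in the polynomial ring, and its image under a ring
  homomorphism is a field as soon as \<open>1\<close> does not map to zero. The latter holds because
  the monomial \<open>1\<close> lies in \<open>N\<close>.\<close>

lemma subfield_scalars:
  "subfield (scalars r complement_ideal) (quot_alg r (complement_ideal :: 'k::field mpoly set))"
proof -
  interpret P: cring "poly_ring r :: 'k mpoly ring" by (rule cring_poly_ring)
  interpret h: ring_hom_ring "poly_ring r :: 'k mpoly ring" "quot_alg r complement_ideal" coset
    by (rule ring_hom_coset)
  let ?K = "range (Poly_Mapping.single 0) :: 'k mpoly set"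
  have carrier_K: "?K \<subseteq> carrier (poly_ring r)"
    by (auto simp: in_carrier_poly_ring exponents_def)
  have K: "subfield ?K (poly_ring r)"
  proof (rule P.subfieldI)
    show "subcring ?K (poly_ring r)"
    proof (rule P.subcringI')
      show "subring ?K (poly_ring r)"
      proof (rule P.subringI)
        show "\<one>\<^bsub>poly_ring r\<^esub> \<in> ?K"
          by (auto intro!: image_eqI[of _ _ 1])
        fix p assume "p \<in> ?K"
        then obtain c where "p = Poly_Mapping.single 0 c" by auto
        moreover have "p \<in> carrier (poly_ring r)"
          using \<open>p \<in> ?K\<close> carrier_K by blast
        ultimately show "\<ominus>\<^bsub>poly_ring r\<^esub> p \<in> ?K"
          by (simp add: a_inv_poly_ring flip: single_uminus)
      qed (use carrier_K in \<open>auto simp: mult_single simp flip: single_add\<close>)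
    qed
    show "Units (poly_ring r \<lparr>carrier := ?K\<rparr>) = ?K - {\<zero>\<^bsub>poly_ring r\<^esub>}"
    proof (intro equalityI subsetI)
      fix p assume p: "p \<in> ?K - {\<zero>\<^bsub>poly_ring r\<^esub>}"
      then obtain c where c: "p = Poly_Mapping.single 0 c" by auto
      with p have "c \<noteq> 0" by auto
      then have "Poly_Mapping.single 0 (inverse c) * p = 1" "p * Poly_Mapping.single 0 (inverse c) = 1"
        using c by (simp_all add: mult_single)
      then show "p \<in> Units (poly_ring r \<lparr>carrier := ?K\<rparr>)"
        using p by (auto simp: Units_def)
    qed (auto simp: Units_def)
  qed
  have "\<one>\<^bsub>quot_alg r complement_ideal\<^esub> \<noteq> \<zero>\<^bsub>quot_alg r (complement_ideal :: 'k mpoly set)\<^esub>"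
    using coset_eq_zero_iff[of "1 :: 'k mpoly"] h.hom_one zero_in_N P.one_closed by simp
  from h.img_is_subfield(2)[OF K this] show ?thesis
    by (simp add: scalars_def)
qed

text \<open>Induction on \<open>T\<close>: each new monomial enlarges the span by a line, matching
  the inductive rule \<open>Suc_dim\<close>.\<close>

lemma dimension_coset_image:
  assumes "finite T" "T \<subseteq> N"
  shows "ring.dimension (quot_alg r complement_ideal) (card T) (scalars r complement_ideal)
    (coset ` {p :: 'k::field mpoly. Poly_Mapping.keys p \<subseteq> T})"
proof -
  interpret h: ring_hom_ring "poly_ring r :: 'k mpoly ring" "quot_alg r complement_ideal" coset
    by (rule ring_hom_coset)
  let ?K = "scalars r (complement_ideal :: 'k mpoly set)"
  let ?E = "\<lambda>T. coset ` {p :: 'k mpoly. Poly_Mapping.keys p \<subseteq> T}"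
  show ?thesis
    using assms
  proof (induction T rule: finite_induct)
    case empty
    have "?E {} = {\<zero>\<^bsub>quot_alg r complement_ideal\<^esub>}"
      using h.hom_zero by simp
    then show ?case
      using h.S.dimension.zero_dim[of ?K] by simp
  next
    case (insert m T)
    let ?v = "coset (Poly_Mapping.single m 1 :: 'k mpoly)"
    have in_carrier: "p \<in> carrier (poly_ring r)"
      if "Poly_Mapping.keys p \<subseteq> insert m T" for p :: "'k mpoly"
      using that insert.prems N_exponents by (auto simp: in_carrier_poly_ring)
    have mono: "Poly_Mapping.single m c \<in> carrier (poly_ring r)" for c :: 'k
      by (rule in_carrier) simp
    have const: "Poly_Mapping.single 0 c \<in> carrier (poly_ring r)" for c :: 'k
      by (simp add: in_carrier_poly_ring exponents_def)
    \<comment> \<open>Linear independence: the coefficient at \<open>m\<close> is well defined on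
      cosets, equals 1 on \<open>?v\<close> and vanishes on the span of \<open>T\<close>.\<close>
    have "?v \<notin> ?E T"
    proof
      assume "?v \<in> ?E T"
      then obtain p :: "'k mpoly" where p: "?v = coset p" "Poly_Mapping.keys p \<subseteq> T" by blast
      then have "Poly_Mapping.keys p \<subseteq> insert m T" by blast
      then have "p \<in> carrier (poly_ring r)" by (rule in_carrier)
      then have "\<forall>n\<in>N. Poly_Mapping.lookup (Poly_Mapping.single m 1) n = Poly_Mapping.lookup p n"
        using p(1) coset_eq_iff[OF mono] by blast
      moreover have "m \<in> N" using insert.prems by blast
      ultimately have "Poly_Mapping.lookup (Poly_Mapping.single m 1 :: 'k mpoly) m = Poly_Mapping.lookup p m"
        by blast
      then have "Poly_Mapping.lookup p m = 1" by simp
      then have "m \<in> Poly_Mapping.keys p" by (simp add: in_keys_iff)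
      then show False
        using p(2) insert.hyps by blast
    qed
    moreover have "?v \<in> carrier (quot_alg r complement_ideal)"
      using h.hom_closed mono by blast
    moreover have "h.S.dimension (card T) ?K (?E T)"
      using insert.IH insert.prems by simp
    ultimately have "h.S.dimension (Suc (card T)) ?K (h.S.line_extension ?K ?v (?E T))"
      by (intro h.S.dimension.Suc_dim)
    moreover have "h.S.line_extension ?K ?v (?E T) = ?E (insert m T)"
    proof -
      have step: "coset (Poly_Mapping.single m c + p)
          = coset (Poly_Mapping.single 0 c) \<otimes>\<^bsub>quot_alg r complement_ideal\<^esub> ?v
            \<oplus>\<^bsub>quot_alg r complement_ideal\<^esub> coset p"
        if "Poly_Mapping.keys p \<subseteq> T" for c and p :: "'k mpoly"
      proof -
        have "coset (Poly_Mapping.single m c) = coset (Poly_Mapping.single 0 c * Poly_Mapping.single m 1)"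
          by (simp add: mult_single)
        moreover have "p \<in> carrier (poly_ring r)"
          using that by (intro in_carrier) auto
        ultimately show ?thesis
          by (simp only: coset_add[OF mono] coset_mult[OF const mono])
      qed
      show ?thesis
      proof (intro equalityI subsetI)
        fix u assume "u \<in> h.S.line_extension ?K ?v (?E T)"
        then obtain c and p :: "'k mpoly" where "Poly_Mapping.keys p \<subseteq> T"
          "u = coset (Poly_Mapping.single 0 c) \<otimes>\<^bsub>quot_alg r complement_ideal\<^esub> ?v
            \<oplus>\<^bsub>quot_alg r complement_ideal\<^esub> coset p"
          unfolding h.S.line_extension_mem_iff scalars_def by blast
        then have p: "Poly_Mapping.keys p \<subseteq> T" "u = coset (Poly_Mapping.single m c + p)"
          using step by simp_all
        have "Poly_Mapping.keys (Poly_Mapping.single m c + p) \<subseteq> insert m T"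
          using Poly_Mapping.keys_add[of "Poly_Mapping.single m c" p] p(1)
          by (auto split: if_splits)
        then show "u \<in> ?E (insert m T)"
          using p(2) by blast
      next
        fix u assume "u \<in> ?E (insert m T)"
        then obtain p :: "'k mpoly" where p: "Poly_Mapping.keys p \<subseteq> insert m T" "u = coset p"
          by auto
        define c where "c = Poly_Mapping.lookup p m"
        define q where "q = p - Poly_Mapping.single m c"
        have "m \<notin> Poly_Mapping.keys q"
          by (simp add: q_def c_def in_keys_iff lookup_minus)
        moreover have "Poly_Mapping.keys q \<subseteq> insert m T"
          using p(1) keys_diff[of p "Poly_Mapping.single m c"]
          by (auto simp: q_def split: if_splits)
        ultimately have "Poly_Mapping.keys q \<subseteq> T" by blast
        moreover have "u = coset (Poly_Mapping.single m c + q)"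
          using p(2) by (simp add: q_def)
        ultimately show "u \<in> h.S.line_extension ?K ?v (?E T)"
          unfolding h.S.line_extension_mem_iff scalars_def using step[of q c] by blast
      qed
    qed
    ultimately show ?case
      using insert.hyps by simp
  qed
qed

lemma graded_piece_eq:
  "graded_piece r complement_ideal i =
    coset ` {p :: 'k::field mpoly. Poly_Mapping.keys p \<subseteq> {m \<in> N. mon_degree m = i}}"
proof (intro equalityI subsetI)
  fix a assume "a \<in> graded_piece r (complement_ideal :: 'k mpoly set) i"
  then obtain p :: "'k mpoly" where p: "p \<in> forms r i" "a = coset p"
    by (auto simp: graded_piece_def)
  then obtain q where "coset q = coset p" "Poly_Mapping.keys q = Poly_Mapping.keys p \<inter> N"
    using normal_form[of p] by (auto simp: forms_def)
  then show "a \<in> coset ` {p :: 'k mpoly. Poly_Mapping.keys p \<subseteq> {m \<in> N. mon_degree m = i}}"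
    using p by (intro image_eqI[of _ _ q]) (auto simp: forms_def)
next
  fix a assume "a \<in> coset ` {p :: 'k mpoly. Poly_Mapping.keys p \<subseteq> {m \<in> N. mon_degree m = i}}"
  then obtain p :: "'k mpoly"
    where "a = coset p" "Poly_Mapping.keys p \<subseteq> {m \<in> N. mon_degree m = i}" by blast
  then show "a \<in> graded_piece r complement_ideal i"
    using N_exponents
    by (auto simp: graded_piece_def forms_def in_carrier_poly_ring intro!: imageI)
qed

lemma hilb_complement_ideal:
  "hilb r (complement_ideal :: 'k::field mpoly set) i = card {m \<in> N. mon_degree m = i}"
proof -
  interpret h: ring_hom_ring "poly_ring r :: 'k mpoly ring" "quot_alg r complement_ideal" coset
    by (rule ring_hom_coset)
  have "h.S.dimension (card {m \<in> N. mon_degree m = i}) (scalars r complement_ideal)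
      (graded_piece r (complement_ideal :: 'k mpoly set) i)"
    unfolding graded_piece_eq by (rule dimension_coset_image) (use finite_N in auto)
  then show ?thesis
    using h.S.dimI[OF subfield_scalars] by (simp add: hilb_def over_def)
qed

section \<open>Socle degree, artinianness and levelness\<close>

text \<open>Purity allows climbing from the monomial \<open>1\<close> one degree at a time up to
  \<open>e\<close>.\<close>

lemma degree_e_nonempty: "\<exists>m\<in>N. mon_degree m = e"
proof -
  have "\<exists>m\<in>N. mon_degree m = d" if "d \<le> e" for d
    using that
  proof (induction d)
    case 0
    then show ?case using zero_in_N by (auto simp: mon_degree_eq_0_iff)
  next
    case (Suc d)
    then obtain m where "m \<in> N" "mon_degree m = d" by auto
    moreover from this obtain i where "m + Poly_Mapping.single i 1 \<in> N"
      using pure[of m] Suc.prems by auto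
    ultimately show ?case by (intro bexI[of _ "m + Poly_Mapping.single i 1"]) simp_all
  qed
  then show ?thesis by simp
qed

lemma socle_degree_complement_ideal: "socle_degree r (complement_ideal :: 'k::field mpoly set) = e"
  unfolding socle_degree_def
proof (rule Greatest_equality)
  obtain m where m: "m \<in> N" "mon_degree m = e" using degree_e_nonempty by blast
  then have "coset (Poly_Mapping.single m 1 :: 'k mpoly) \<noteq> \<zero>\<^bsub>quot_alg r complement_ideal\<^esub>"
    using N_exponents by (subst coset_eq_zero_iff) (auto simp: in_carrier_poly_ring)
  moreover have "coset (Poly_Mapping.single m 1 :: 'k mpoly) \<in> graded_piece r complement_ideal e"
    using m unfolding graded_piece_eq by simp
  ultimately show "graded_piece r (complement_ideal :: 'k mpoly set) e \<noteq> {\<zero>\<^bsub>quot_alg r complement_ideal\<^esub>}"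
    by blast
next
  fix i assume i: "graded_piece r (complement_ideal :: 'k mpoly set) i \<noteq> {\<zero>\<^bsub>quot_alg r complement_ideal\<^esub>}"
  interpret h: ring_hom_ring "poly_ring r :: 'k mpoly ring" "quot_alg r complement_ideal" coset
    by (rule ring_hom_coset)
  have "{m \<in> N. mon_degree m = i} \<noteq> {}"
  proof
    assume empty: "{m \<in> N. mon_degree m = i} = {}"
    show False using i h.hom_zero unfolding graded_piece_eq empty by simp
  qed
  then show "i \<le> e" using degree_le by blast
qed

text \<open>Every ideal of the quotient is a subspace over the constants, and the quotient has the
  finite set \<open>N\<close> as a basis, so a descending chain of ideals stabilises.\<close>

lemma artinian_complement_ideal: "artinian_ring (quot_alg r (complement_ideal :: 'k::field mpoly set))"
  unfolding artinian_ring_def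
proof (intro conjI allI impI)
  interpret h: ring_hom_ring "poly_ring r :: 'k mpoly ring" "quot_alg r complement_ideal" coset
    by (rule ring_hom_coset)
  show "ring (quot_alg r (complement_ideal :: 'k mpoly set))" by (rule h.S.ring_axioms)
  fix J :: "nat \<Rightarrow> 'k mpoly set set"
  assume J: "\<forall>n. ideal (J n) (quot_alg r complement_ideal) \<and> J (Suc n) \<subseteq> J n"
  \<comment> \<open>The normal forms of the elements of \<open>J n\<close>. They recover
    \<open>J n\<close> as their image under \<open>coset\<close>, so stabilisation of
    \<open>V\<close> transfers back.\<close>
  define V where "V n = {p. Poly_Mapping.keys p \<subseteq> N \<and> coset p \<in> J n}" for n
  have in_carrier: "p \<in> carrier (poly_ring r)" if "Poly_Mapping.keys p \<subseteq> N" for p :: "'k mpoly"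
    using that N_exponents by (auto simp: in_carrier_poly_ring)
  have "\<exists>M. \<forall>n\<ge>M. V n = V M"
  proof (rule decreasing_subspaces_stabilise[OF finite_N])
    fix n
    interpret Jn: ideal "J n" "quot_alg r complement_ideal" using J by blast
    show "0 \<in> V n" using h.hom_zero Jn.zero_closed by (simp add: V_def)
    fix p q c assume pq: "p \<in> V n" "q \<in> V n"
    let ?s = "Poly_Mapping.single 0 (- c) :: 'k mpoly"
    have s: "?s \<in> carrier (poly_ring r)"
      by (simp add: in_carrier_poly_ring exponents_def)
    have "Poly_Mapping.keys (Poly_Mapping.single 0 c * q) \<subseteq> Poly_Mapping.keys q"
      by (auto simp: in_keys_iff)
    then have keys: "Poly_Mapping.keys (p - Poly_Mapping.single 0 c * q) \<subseteq> N"
      using pq keys_diff[of p "Poly_Mapping.single 0 c * q"] unfolding V_def by blast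
    have pc: "p \<in> carrier (poly_ring r)" and qc: "q \<in> carrier (poly_ring r)"
      by (rule in_carrier, use pq in \<open>simp add: V_def\<close>)+
    have sq: "?s * q \<in> carrier (poly_ring r)"
      using h.R.m_closed[OF s qc] by (simp only: poly_ring_simps)
    have "p - Poly_Mapping.single 0 c * q = p + ?s * q"
      by (rule poly_mapping_eqI) (simp add: lookup_minus lookup_add)
    then have "coset (p - Poly_Mapping.single 0 c * q) = coset (p + ?s * q)"
      by (rule arg_cong)
    also have "\<dots> = coset p \<oplus>\<^bsub>quot_alg r complement_ideal\<^esub> (coset ?s \<otimes>\<^bsub>quot_alg r complement_ideal\<^esub> coset q)"
      unfolding coset_add[OF pc sq] coset_mult[OF s qc] by (rule refl)
    also have "\<dots> \<in> J n"
      using pq s h.hom_closed by (intro Jn.a_closed Jn.I_l_closed) (auto simp: V_def)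
    finally show "p - Poly_Mapping.single 0 c * q \<in> V n"
      using keys by (simp add: V_def)
  qed (use J in \<open>auto simp: V_def\<close>)
  then obtain M where M: "\<And>n. n \<ge> M \<Longrightarrow> V n = V M" by blast
  have J_eq: "J n = coset ` V n" for n
  proof (intro equalityI subsetI)
    interpret Jn: ideal "J n" "quot_alg r complement_ideal" using J by blast
    fix a assume a: "a \<in> J n"
    then have "a \<in> coset ` carrier (poly_ring r)"
      using Jn.a_subset unfolding carrier_quot_alg by (rule rev_subsetD)
    then obtain p :: "'k mpoly" where p: "p \<in> carrier (poly_ring r)" "a = coset p"
      by blast
    obtain q where q: "coset q = coset p" "Poly_Mapping.keys q = Poly_Mapping.keys p \<inter> N"
      by (rule normal_form[OF p(1)])
    show "a \<in> coset ` V n"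
      using a p(2) q by (intro image_eqI[of _ _ q]) (simp_all add: V_def)
  next
    fix a assume "a \<in> coset ` V n"
    then show "a \<in> J n" unfolding V_def by blast
  qed
  show "\<exists>M. \<forall>n\<ge>M. J n = J M"
    unfolding J_eq by (intro exI[of _ M] allI impI arg_cong[where f = "(`) coset"] M)
qed

text \<open>If the normal form of a socle element contained a monomial \<open>m\<close> of degree
  below \<open>e\<close>, purity would give a variable whose product with \<open>m\<close> is in
  \<open>N\<close>. Its coefficient in the product is that of \<open>m\<close>, so the product would
  be nonzero.\<close>

lemma level_complement_ideal: "level r (complement_ideal :: 'k::field mpoly set)"
  unfolding level_def socle_degree_complement_ideal
proof
  fix a assume a: "a \<in> socle r (complement_ideal :: 'k mpoly set)"
  then obtain p' :: "'k mpoly" where p': "p' \<in> carrier (poly_ring r)" "a = coset p'"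
    unfolding socle_def carrier_quot_alg by blast
  obtain p where "coset p = coset p'" "Poly_Mapping.keys p = Poly_Mapping.keys p' \<inter> N"
    by (rule normal_form[OF p'(1)])
  then have p: "a = coset p" "Poly_Mapping.keys p \<subseteq> N"
    using p'(2) by simp_all
  then have carrier_p: "p \<in> carrier (poly_ring r)"
    using N_exponents by (auto simp: in_carrier_poly_ring)
  interpret P: cring "poly_ring r :: 'k mpoly ring" by (rule cring_poly_ring)
  have "mon_degree m = e" if m: "m \<in> Poly_Mapping.keys p" for m
  proof (rule ccontr)
    assume "mon_degree m \<noteq> e"
    then have "mon_degree m < e" "m \<in> N" using degree_le[of m] m p(2) by auto
    then obtain i where i: "i < r" "m + Poly_Mapping.single i 1 \<in> N" using pure by blast
    let ?x = "Poly_Mapping.single (Poly_Mapping.single i 1) 1 :: 'k mpoly"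
    have x: "?x \<in> carrier (poly_ring r)"
      using i single_in_exponents by (simp add: in_carrier_poly_ring)
    then have "coset ?x \<in> max_hom_ideal r complement_ideal"
      unfolding max_hom_ideal_def by (intro imageI) simp
    then have "coset (p * ?x) = \<zero>\<^bsub>quot_alg r complement_ideal\<^esub>"
      using a unfolding socle_def p(1) coset_mult[OF carrier_p x] by blast
    then have "Poly_Mapping.keys (p * ?x) \<inter> N = {}"
      using coset_eq_zero_iff[of "p * ?x"] P.m_closed[OF carrier_p x] by simp
    moreover have "m + Poly_Mapping.single i 1 \<in> Poly_Mapping.keys (p * ?x)"
      using m by (simp add: in_keys_iff lookup_times_monom)
    ultimately show False using i by blast
  qed
  then show "a \<in> graded_piece r complement_ideal e"
    using p unfolding graded_piece_eq by auto
qed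

end


section \<open>A non-unimodal example\<close>

text \<open>The three distinguished variables have indices 0, 1 and 2 here, as variables are
  numbered from 0.\<close>

definition tri :: "nat \<Rightarrow> nat \<Rightarrow> nat \<Rightarrow> nat \<Rightarrow>\<^sub>0 nat" where
  "tri i j k = Poly_Mapping.single 0 i + Poly_Mapping.single 1 j + Poly_Mapping.single 2 k"

lemma lookup_tri:
  "Poly_Mapping.lookup (tri i j k) l = (if l = 0 then i else if l = 1 then j else if l = 2 then k else 0)"
  by (simp add: tri_def lookup_add lookup_single when_def)

lemma mon_degree_tri [simp]: "mon_degree (tri i j k) = i + j + k"
  by (simp add: tri_def)

lemma eq_triI:
  assumes "Poly_Mapping.keys m \<subseteq> {..<3}"
  shows "m = tri (Poly_Mapping.lookup m 0) (Poly_Mapping.lookup m 1) (Poly_Mapping.lookup m 2)"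
proof (rule poly_mapping_eqI)
  fix l
  have "Poly_Mapping.lookup m l = 0" if "l \<noteq> 0" "l \<noteq> 1" "l \<noteq> 2"
    using assms that by (auto simp: in_keys_iff subset_iff)
  then show "Poly_Mapping.lookup m l
      = Poly_Mapping.lookup (tri (Poly_Mapping.lookup m 0) (Poly_Mapping.lookup m 1) (Poly_Mapping.lookup m 2)) l"
    by (simp add: lookup_tri)
qed

text \<open>The last disjunct describes the divisors of the fourth power of the product of the three
  variables; the first three describe monomials in at most two of them.\<close>

definition admissible :: "nat \<Rightarrow> nat \<Rightarrow> nat \<Rightarrow> bool" where
  "admissible i j k \<longleftrightarrow> i + j + k \<le> 12 \<and> (i = 0 \<or> j = 0 \<or> k = 0 \<or> i \<le> 4 \<and> j \<le> 4 \<and> k \<le> 4)"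

definition example_monomials :: "nat \<Rightarrow> (nat \<Rightarrow>\<^sub>0 nat) set" where
  "example_monomials r = {tri i j k | i j k. admissible i j k} \<union> {Poly_Mapping.single l d | l d. l \<in> {3..<r} \<and> d \<le> 12}"

lemma pure_order_ideal_example:
  assumes "3 \<le> r"
  shows "pure_order_ideal r 12 (example_monomials r)"
proof
  show "example_monomials r \<subseteq> exponents r"
    using assms by (auto simp: example_monomials_def exponents_def in_keys_iff lookup_tri split: if_splits)
  have "example_monomials r \<subseteq> (\<lambda>(i, j, k). tri i j k) ` ({..12} \<times> {..12} \<times> {..12})
      \<union> (\<lambda>(l, d). Poly_Mapping.single l d) ` ({3..<r} \<times> {..12})"
  proof
    fix m assume "m \<in> example_monomials r"
    then consider i j k where "m = tri i j k" "admissible i j k"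
      | l d where "m = Poly_Mapping.single l d" "l \<in> {3..<r}" "d \<le> 12"
      unfolding example_monomials_def by blast
    then show "m \<in> (\<lambda>(i, j, k). tri i j k) ` ({..12} \<times> {..12} \<times> {..12})
      \<union> (\<lambda>(l, d). Poly_Mapping.single l d) ` ({3..<r} \<times> {..12})"
    proof cases
      case (1 i j k)
      then have "(i, j, k) \<in> {..12} \<times> {..12} \<times> {..12}" by (auto simp: admissible_def)
      then show ?thesis unfolding 1(1) by (intro UnI1 image_eqI[of _ _ "(i, j, k)"]) simp_all
    next
      case (2 l d)
      then show ?thesis by (intro UnI2 image_eqI[of _ _ "(l, d)"]) simp_all
    qed
  qed
  then show "finite (example_monomials r)"
    by (rule finite_subset) simp
  have "0 = tri 0 0 0" by (simp add: tri_def)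
  moreover have "admissible 0 0 0" by (simp add: admissible_def)
  ultimately show "0 \<in> example_monomials r" unfolding example_monomials_def by blast
next
  fix m n assume "m + n \<in> example_monomials r"
  then consider i j k where "m + n = tri i j k" "admissible i j k"
    | l d where "m + n = Poly_Mapping.single l d" "l \<in> {3..<r}" "d \<le> 12"
    unfolding example_monomials_def by blast
  then show "m \<in> example_monomials r"
  proof cases
    case (1 i j k)
    have eq: "Poly_Mapping.lookup m l + Poly_Mapping.lookup n l = Poly_Mapping.lookup (tri i j k) l" for l
      using 1(1) by (metis lookup_add)
    have "Poly_Mapping.keys m \<subseteq> {..<3}"
    proof
      fix l assume "l \<in> Poly_Mapping.keys m"
      then show "l \<in> {..<3}"
        using eq[of l] by (auto simp: in_keys_iff lookup_tri split: if_splits)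
    qed
    then have "m = tri (Poly_Mapping.lookup m 0) (Poly_Mapping.lookup m 1) (Poly_Mapping.lookup m 2)"
      by (rule eq_triI)
    moreover have "admissible (Poly_Mapping.lookup m 0) (Poly_Mapping.lookup m 1) (Poly_Mapping.lookup m 2)"
      using 1(2) eq[of 0] eq[of 1] eq[of 2] by (auto simp: admissible_def lookup_tri)
    ultimately show ?thesis unfolding example_monomials_def by blast
  next
    case (2 l d)
    have eq: "Poly_Mapping.lookup m x + Poly_Mapping.lookup n x
        = Poly_Mapping.lookup (Poly_Mapping.single l d) x" for x
      using 2(1) by (metis lookup_add)
    have "m = Poly_Mapping.single l (Poly_Mapping.lookup m l)"
    proof (rule poly_mapping_eqI)
      fix x show "Poly_Mapping.lookup m x
          = Poly_Mapping.lookup (Poly_Mapping.single l (Poly_Mapping.lookup m l)) x"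
        using eq[of x] by (auto simp: lookup_single when_def)
    qed
    moreover have "Poly_Mapping.lookup m l \<le> 12"
      using eq[of l] 2(3) by simp
    ultimately show ?thesis using 2(2) unfolding example_monomials_def by blast
  qed
next
  fix m assume "m \<in> example_monomials r"
  then show "mon_degree m \<le> 12"
    by (auto simp: example_monomials_def admissible_def)
next
  fix m assume m: "m \<in> example_monomials r" "mon_degree m < 12"
  then consider i j k where "m = tri i j k" "admissible i j k"
    | l d where "m = Poly_Mapping.single l d" "l \<in> {3..<r}"
    unfolding example_monomials_def by blast
  then show "\<exists>i<r. m + Poly_Mapping.single i 1 \<in> example_monomials r"
  proof cases
    case (1 i j k)
    have step: "m + Poly_Mapping.single 0 1 = tri (Suc i) j k" "m + Poly_Mapping.single 1 1 = tri i (Suc j) k"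
      "m + Poly_Mapping.single 2 1 = tri i j (Suc k)"
      by (rule poly_mapping_eqI, simp add: 1 lookup_add lookup_tri lookup_single when_def)+
    have "i + j + k < 12" using m(2) 1(1) by simp
    \<comment> \<open>If some exponent is zero, another one can be raised while it stays zero.
      Otherwise all are at most 4 with sum below 12, so one of them is below 4 and can be
      raised.\<close>
    then have "admissible (Suc i) j k \<or> admissible i (Suc j) k \<or> admissible i j (Suc k)"
      using 1(2) unfolding admissible_def by presburger
    then have "m + Poly_Mapping.single 0 1 \<in> example_monomials r \<or> m + Poly_Mapping.single 1 1 \<in> example_monomials r
        \<or> m + Poly_Mapping.single 2 1 \<in> example_monomials r"
      unfolding step unfolding example_monomials_def by blast
    moreover have "0 < r" "1 < r" "2 < r" using assms by auto
    ultimately show ?thesis by blast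
  next
    case (2 l d)
    have "m + Poly_Mapping.single l 1 = Poly_Mapping.single l (Suc d)"
      by (simp add: 2 flip: single_add)
    moreover have "Suc d \<le> 12" using m(2) 2(1) by simp
    ultimately have "m + Poly_Mapping.single l 1 \<in> example_monomials r"
      unfolding example_monomials_def using 2(2) by blast
    then show ?thesis using 2(2) by auto
  qed
qed

section \<open>Counting the monomials by degree\<close>

text \<open>Exponent triples of total degree \<open>d\<close>, with the third exponent recovered as
  \<open>d - i - j\<close>; the condition \<open>i + j \<le> d\<close> prevents truncated
  subtraction. Filtering a finite box makes the set computable.\<close>

definition pairs :: "nat \<Rightarrow> (nat \<times> nat) set" where
  "pairs d = Set.filter (\<lambda>(i, j). i + j \<le> d \<and> admissible i j (d - i - j)) ({..d} \<times> {..d})"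

text \<open>By the count of monomials in at most two variables plus multiples of all three, the
  values are 3 + 0, 27 + 10, 30 + 6, 33 + 3 and 36 + 1. Degree 1 gives the codimension, the others
  the valley.\<close>

lemma card_pairs: "card (pairs 1) = 3" "card (pairs 9) = 37" "card (pairs 10) = 36"
   "card (pairs 11) = 36" "card (pairs 12) = 37"
  by code_simp+

text \<open>In positive degree the two families are disjoint and each further variable contributes
  exactly one power. In degree 0 they would share the monomial \<open>1\<close>.\<close>

lemma card_example_degree:
  assumes "1 \<le> d" "d \<le> 12" "3 \<le> r"
  shows "card {m \<in> example_monomials r. mon_degree m = d} = card (pairs d) + (r - 3)"
proof -
  let ?t = "\<lambda>(i, j). tri i j (d - i - j)" and ?s = "\<lambda>l. Poly_Mapping.single l d"
  have "{m \<in> example_monomials r. mon_degree m = d} = ?t ` pairs d \<union> ?s ` {3..<r}"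
  proof (intro equalityI subsetI)
    fix m assume m: "m \<in> {m \<in> example_monomials r. mon_degree m = d}"
    then consider i j k where "m = tri i j k" "admissible i j k" "i + j + k = d"
      | l where "m = Poly_Mapping.single l d" "l \<in> {3..<r}"
      unfolding example_monomials_def by auto
    then show "m \<in> ?t ` pairs d \<union> ?s ` {3..<r}"
    proof cases
      case (1 i j k)
      then have "d - i - j = k" by simp
      with 1 have "(i, j) \<in> pairs d" "m = ?t (i, j)"
        by (auto simp: pairs_def)
      then show ?thesis by blast
    qed auto
  next
    fix m assume "m \<in> ?t ` pairs d \<union> ?s ` {3..<r}"
    then show "m \<in> {m \<in> example_monomials r. mon_degree m = d}"
      using assms unfolding example_monomials_def pairs_def by fastforce
  qed
  moreover have "?t ` pairs d \<inter> ?s ` {3..<r} = {}"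
  proof -
    have "tri i j k \<noteq> Poly_Mapping.single l d" if "3 \<le> l" for i j k l
    proof
      assume "tri i j k = Poly_Mapping.single l d"
      then have "Poly_Mapping.lookup (tri i j k) l = d" by simp
      then show False using that assms(1) by (simp add: lookup_tri)
    qed
    then show ?thesis by fastforce
  qed
  moreover have "inj_on ?t (pairs d)"
  proof (rule inj_onI)
    fix x y assume "?t x = ?t y"
    then have "Poly_Mapping.lookup (?t x) 0 = Poly_Mapping.lookup (?t y) 0"
      "Poly_Mapping.lookup (?t x) 1 = Poly_Mapping.lookup (?t y) 1" by simp_all
    then show "x = y" by (simp add: lookup_tri split: prod.splits)
  qed
  moreover have "inj_on ?s {3..<r}"
  proof (rule inj_onI)
    fix l l' assume "?s l = ?s l'"
    then have "Poly_Mapping.lookup (?s l) l = Poly_Mapping.lookup (?s l') l" by simp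
    then show "l = l'" using assms(1) by (simp add: lookup_single when_def split: if_splits)
  qed
  moreover have "finite (pairs d)" by (simp add: pairs_def)
  ultimately show ?thesis
    by (simp add: card_Un_disjoint card_image)
qed

section \<open>Linear forms and the failure of unimodality\<close>

text \<open>Every variable belongs to the order ideal; hence no nonzero linear form can lie in the
  complementary ideal.\<close>

lemma keys_form_1_subset:
  assumes "p \<in> forms r 1" "3 \<le> r"
  shows "Poly_Mapping.keys p \<subseteq> example_monomials r"
proof
  fix m assume "m \<in> Poly_Mapping.keys p"
  then have m: "Poly_Mapping.keys m \<subseteq> {..<r}" "mon_degree m = 1"
    using assms(1) by (auto simp: forms_def in_carrier_poly_ring exponents_def)
  then have "m \<noteq> 0" by (auto simp: mon_degree_def)
  then obtain l where l: "l \<in> Poly_Mapping.keys m" by (metis keys_eq_empty ex_in_conv)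
  \<comment> \<open>Since \<open>l\<close> occurs in \<open>m\<close>, this subtraction is not
    truncated, and comparing degrees forces \<open>n\<close> to be \<open>0\<close>.\<close>
  define n where "n = m - Poly_Mapping.single l 1"
  have eq: "m = n + Poly_Mapping.single l 1"
    using l by (intro poly_mapping_eqI) (auto simp: n_def lookup_minus lookup_add lookup_single when_def in_keys_iff)
  then have "n = 0" using m(2) mon_degree_eq_0_iff[of n] by simp
  then have m_eq: "m = Poly_Mapping.single l 1" using eq by simp
  have "l < r" using l m(1) by auto
  show "m \<in> example_monomials r"
  proof (cases "l < 3")
    case True
    then have "Poly_Mapping.keys m \<subseteq> {..<3}" by (simp add: m_eq)
    then have "m = tri (Poly_Mapping.lookup m 0) (Poly_Mapping.lookup m 1) (Poly_Mapping.lookup m 2)"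
      by (rule eq_triI)
    moreover have "admissible (Poly_Mapping.lookup m 0) (Poly_Mapping.lookup m 1) (Poly_Mapping.lookup m 2)"
      by (auto simp: admissible_def m_eq lookup_single when_def)
    ultimately show ?thesis unfolding example_monomials_def by blast
  next
    case False
    then have "l \<in> {3..<r}" "(1::nat) \<le> 12" using \<open>l < r\<close> by auto
    then show ?thesis unfolding example_monomials_def m_eq by blast
  qed
qed

text \<open>A strict descent at \<open>a\<close> forces the peak to be at most \<open>a\<close>, and
  a strict ascent at \<open>b\<close> forces it beyond \<open>b\<close>.\<close>

lemma not_unimodal_if_valley:
  assumes "a < b" "h ! Suc a < h ! a" "h ! b < h ! Suc b" "Suc b < length h"
  shows "\<not> unimodal h"
proof
  assume "unimodal h"
  then obtain j where "\<forall>i<j. h ! i \<le> h ! Suc i"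
    "\<forall>i. j \<le> i \<and> Suc i < length h \<longrightarrow> h ! Suc i \<le> h ! i"
    unfolding unimodal_def by blast
  then have "\<not> a < j" "\<not> j \<le> b" using assms(2-4) by (metis not_le)+
  then show False using assms(1) by simp
qed

theorem theorem5p3:
  fixes r :: nat
  assumes "3 \<le> r"
  shows "\<exists>I :: 'k::field_char_0 mpoly set.
    monomial_ideal r I \<and>
    I \<inter> forms r 1 \<subseteq> {0} \<and>
    codimension r I = r \<and>
    artinian_ring (quot_alg r I) \<and>
    level r I \<and>
    \<not> unimodal (h_vector r I)"
proof -
  interpret pure_order_ideal r 12 "example_monomials r"
    by (rule pure_order_ideal_example[OF assms])
  let ?I = "complement_ideal :: 'k mpoly set"
  have hilb: "hilb r ?I d = card (pairs d) + (r - 3)" if "1 \<le> d" "d \<le> 12" for d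
    using that assms by (simp only: hilb_complement_ideal card_example_degree)
  have "?I \<inter> forms r 1 \<subseteq> {0}"
  proof
    fix p assume "p \<in> ?I \<inter> forms r 1"
    then have "Poly_Mapping.keys p \<inter> example_monomials r = {}" "Poly_Mapping.keys p \<subseteq> example_monomials r"
      using keys_form_1_subset[OF _ assms] unfolding complement_ideal_def by blast+
    then have "Poly_Mapping.keys p = {}" by blast
    then show "p \<in> {0}" by simp
  qed
  moreover have "codimension r ?I = r"
    unfolding codimension_def using hilb[of 1] assms unfolding card_pairs by simp
  moreover have "\<not> unimodal (h_vector r ?I)"
  \<comment> \<open>The descent is from degree 9 to 10 and the ascent from 11 to 12. The summand
    \<open>r - 3\<close> shifts all these entries equally and so preserves both strict
    inequalities.\<close>
  proof (rule not_unimodal_if_valley[of 9 11])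
    have nth: "h_vector r ?I ! d = hilb r ?I d" if "d \<le> 12" for d
      using that unfolding h_vector_def socle_degree_complement_ideal by (simp del: upt_Suc)
    have "h_vector r ?I ! 9 = 37 + (r - 3)" "h_vector r ?I ! 10 = 36 + (r - 3)"
      "h_vector r ?I ! 11 = 36 + (r - 3)" "h_vector r ?I ! 12 = 37 + (r - 3)"
      by (simp_all add: nth hilb card_pairs)
    then show "h_vector r ?I ! Suc 9 < h_vector r ?I ! 9" "h_vector r ?I ! 11 < h_vector r ?I ! Suc 11"
      by simp_all
    show "Suc 11 < length (h_vector r ?I)"
      unfolding h_vector_def socle_degree_complement_ideal by simp
  qed simp
  ultimately show ?thesis
    using monomial_ideal_complement_ideal artinian_complement_ideal level_complement_ideal by blast
qed

end
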